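(* Let $m>0$, $c>0$, $\hbar>0$, and let $\varphi(x,t)=\exp\!\big[R(x,t)+\tfrac{i}{\hbar}S(x,t)\big]$, $x\in\mathbb{R}^3$, $t\ge 0$, with $R,S$ smooth and real-valued, be a solution of the Klein–Gordon equation $$\Delta\varphi-\frac{1}{c^2}\frac{\partial^2\varphi}{\partial t^2}=\frac{m^2c^2}{\hbar^2}\varphi$$ such that $S$ satisfies $$\frac{\partial S}{\partial t}+c\sqrt{m^2c^2+\nabla S\cdot\nabla S}=0 .$$ Write $x_\nu=(x,x^4)$ with $x^4=ict$, set $\tilde S(x_\nu)=S(x,t)$, $\tilde R(x_\nu)=R(x,t)$, let $\nabla_\nu=(\nabla,\partial/\partial x^4)$ and $\Delta_\nu=\nabla_\nu\cdot\nabla_\nu$, and let $\Sigma^2=\begin{pmatrix}\frac{\hbar}{m}I_3&0\\0&0\end{pmatrix}$. Consider the diffusion $\tilde X_\nu(\tau)$ with forward Itô differential $$d\tilde X_\nu(\tau)=\Big(\tfrac1m\nabla_\nu\tilde S+\Sigma^2\nabla_\nu\tilde R\Big)(\tilde X_\nu(\tau))\,d\tau+\Sigma\, d\tilde W_\nu(\tau),$$ with $\tilde W_\nu$ a standard four-dimensional Wiener process (equivalently, spatial part $d\tilde X=\big(\tfrac1m\nabla S+\tfrac{\hbar}{m}\nabla R\big)d\tau+\sqrt{\hbar/m}\,d\tilde W$ and time part $dT=-\tfrac{1}{mc^2}\tfrac{\partial S}{\partial t}\,d\tau$ where $\tilde X^4=icT$). Then $\tilde\rho(x_\nu)=|\varphi(x_\nu)|^2$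 is a stationary solution of the associated Fokker–Planck equation $$\frac{\partial\rho_\nu}{\partial\tau}+\nabla_\nu\cdot\Big[\Big(\tfrac1m\nabla_\nu\tilde S+\Sigma^2\nabla_\nu\tilde R\Big)\rho_\nu\Big]=\tfrac12\Sigma^2\Delta_\nu\rho_\nu,$$ so that $\mu(dx_\nu)=\tilde\rho(x_\nu)\,dx_\nu$ is an invariant ($\sigma$-finite) measure for this process; moreover $\tilde\rho$ satisfies the covariant continuity equation $$\nabla_\nu\cdot\Big(\tilde\rho\,\tfrac1m\nabla_\nu\tilde S\Big)=0,$$ i.e. $\nabla\cdot(|\varphi|^2\nabla S)-\frac{1}{c^2}\frac{\partial}{\partial t}\big(|\varphi|^2\frac{\partial S}{\partial t}\big)=0$.
   Context: Here $\nabla$ and $\Delta$ denote the spatial gradient and Laplacian on $\mathbb{R}^3$, and $\partial/\partial x^4=\frac{1}{ic}\partial/\partial t$ under the identification $x^4=ict$. In the expression $\tfrac12\Sigma^2\Delta_\nu\rho_\nu$, the matrix $\Sigma^2$ acts so that only the spatial second derivatives appear, i.e. it equals $\frac{\hbar}{2m}\Delta\rho_\nu$. *)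

theory Defs
  imports "HOL-Analysis.Analysis"
begin

definition px :: "3 \<Rightarrow> (real^3 \<Rightarrow> real \<Rightarrow> 'b::real_normed_vector) \<Rightarrow> real^3 \<Rightarrow> real \<Rightarrow> 'b" where
  "px i f x t = vector_derivative (\<lambda>h. f (x + h *\<^sub>R axis i 1) t) (at 0)"

definition pt :: "(real^3 \<Rightarrow> real \<Rightarrow> 'b::real_normed_vector) \<Rightarrow> real^3 \<Rightarrow> real \<Rightarrow> 'b" where
  "pt f x t = vector_derivative (\<lambda>s. f x s) (at t)"

definition lap :: "(real^3 \<Rightarrow> real \<Rightarrow> 'b::real_normed_vector) \<Rightarrow> real^3 \<Rightarrow> real \<Rightarrow> 'b" where
  "lap f x t = (\<Sum>i\<in>UNIV. px i (px i f) x t)"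

definition dirder :: "'a::euclidean_space \<Rightarrow> ('a \<Rightarrow> 'b::real_normed_vector) \<Rightarrow> 'a \<Rightarrow> 'b" where
  "dirder v f p = vector_derivative (\<lambda>h. f (p + h *\<^sub>R v)) (at 0)"

fun iter_dirder :: "'a::euclidean_space list \<Rightarrow> ('a \<Rightarrow> 'b::real_normed_vector) \<Rightarrow> 'a \<Rightarrow> 'b" where
  "iter_dirder [] f = f"
| "iter_dirder (v # vs) f = dirder v (iter_dirder vs f)"

definition smooth_fun :: "('a::euclidean_space \<Rightarrow> 'b::real_normed_vector) \<Rightarrow> bool" where
  "smooth_fun f \<longleftrightarrow> (\<forall>vs. set vs \<subseteq> Basis \<longrightarrow>
      continuous_on UNIV (iter_dirder vs f) \<and>
      (\<forall>v\<in>Basis. \<forall>p. (\<lambda>h. iter_dirder vs f (p + h *\<^sub>R v)) differentiable (at 0)))"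

text \<open>Four-vector calculus with x^4 = i c t, so d/dx^4 = (1/(i c)) d/dt.
  A four-vector is a pair (spatial part in complex^3, fourth component).\<close>

definition p4 :: "real \<Rightarrow> (real^3 \<Rightarrow> real \<Rightarrow> complex) \<Rightarrow> real^3 \<Rightarrow> real \<Rightarrow> complex" where
  "p4 c f x t = (1 / (\<i> * complex_of_real c)) * pt f x t"

definition grad4 :: "real \<Rightarrow> (real^3 \<Rightarrow> real \<Rightarrow> complex) \<Rightarrow> real^3 \<Rightarrow> real \<Rightarrow> (complex^3) \<times> complex" where
  "grad4 c f x t = ((\<chi> i. px i f x t), p4 c f x t)"

definition div4 :: "real \<Rightarrow> (real^3 \<Rightarrow> real \<Rightarrow> (complex^3) \<times> complex) \<Rightarrow> real^3 \<Rightarrow> real \<Rightarrow> complex" where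
  "div4 c V x t = (\<Sum>i\<in>UNIV. px i (\<lambda>y s. fst (V y s) $ i) x t) + p4 c (\<lambda>y s. snd (V y s)) x t"

definition Sigma2 :: "real \<Rightarrow> real \<Rightarrow> (complex^3) \<times> complex \<Rightarrow> (complex^3) \<times> complex" where
  "Sigma2 m hbar w = ((hbar / m) *\<^sub>R fst w, 0)"

definition cfun :: "(real^3 \<Rightarrow> real \<Rightarrow> real) \<Rightarrow> real^3 \<Rightarrow> real \<Rightarrow> complex" where
  "cfun f x t = complex_of_real (f x t)"

definition drift :: "real \<Rightarrow> real \<Rightarrow> real \<Rightarrow> (real^3 \<Rightarrow> real \<Rightarrow> real) \<Rightarrow> (real^3 \<Rightarrow> real \<Rightarrow> real)
    \<Rightarrow> real^3 \<Rightarrow> real \<Rightarrow> (complex^3) \<times> complex" where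
  "drift c m hbar S R x t = (1 / m) *\<^sub>R grad4 c (cfun S) x t + Sigma2 m hbar (grad4 c (cfun R) x t)"

end

theory Submission
  imports Defs
begin

text \<open>Write \<open>\<phi> = exp G\<close> with \<open>G = R + iS/hbar\<close>; every second derivative of \<open>\<phi>\<close> is
  \<open>\<phi> (G'\<^sup>2 + G'')\<close>. Dividing the Klein-Gordon equation by \<open>\<phi>\<close> and taking imaginary parts
  (the mass term is real) leaves \<open>2 \<nabla>\<^sub>\<nu>R \<cdot> \<nabla>\<^sub>\<nu>S + \<Delta>\<^sub>\<nu>S = 0\<close>, that is
  \<open>\<nabla>\<^sub>\<nu>\<cdot>(e\<^sup>2\<^sup>R \<nabla>\<^sub>\<nu>S) = 0\<close>, which is the continuity equation because
  \<open>|\<phi>|\<^sup>2 = e\<^sup>2\<^sup>R\<close>. In the Fokker-Planck equation the density does not depend on \<open>\<tau>\<close>,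
  the drift term \<open>\<nabla>\<^sub>\<nu>S/m\<close> contributes this vanishing divergence, and the osmotic term
  \<open>(hbar/m) e\<^sup>2\<^sup>R \<nabla>R = (hbar/2m) \<nabla>e\<^sup>2\<^sup>R\<close> contributes exactly \<open>(hbar/2m) \<Delta>\<rho>\<close>.\<close>

lemma vector_derivative_at_shift:
  fixes f :: "real \<Rightarrow> real"
  shows "vector_derivative f (at t) = vector_derivative (\<lambda>h. f (t + h)) (at 0)"
proof -
  have "(f has_vector_derivative d) (at t) \<longleftrightarrow> ((\<lambda>h. f (t + h)) has_vector_derivative d) (at 0)" for d
    using DERIV_shift[of f d 0 t]
    by (simp add: has_real_derivative_iff_has_vector_derivative add.commute)
  then show ?thesis
    unfolding vector_derivative_def by simp
qed

lemma has_real_derivative_vector_derivative_shift: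
  fixes f :: "real \<Rightarrow> real"
  assumes "(\<lambda>h. f (t + h)) differentiable (at 0)"
  shows "(f has_real_derivative vector_derivative f (at t)) (at t)"
proof -
  have "((\<lambda>h. f (t + h)) has_vector_derivative vector_derivative f (at t)) (at 0)"
    using assms vector_derivative_works vector_derivative_at_shift by metis
  then have "((\<lambda>h. f (h + t)) has_real_derivative vector_derivative f (at t)) (at 0)"
    by (simp add: has_real_derivative_iff_has_vector_derivative add.commute)
  then show ?thesis
    using DERIV_shift[of f _ 0 t] by simp
qed

lemma px_eqI:
  "((\<lambda>h. f (x + h *\<^sub>R axis i 1) t) has_vector_derivative d) (at 0) \<Longrightarrow> px i f x t = d"
  unfolding px_def by (rule vector_derivative_at)

lemma pt_eqI:
  "((\<lambda>s. f x s) has_vector_derivative d) (at t) \<Longrightarrow> pt f x t = d"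
  unfolding pt_def by (rule vector_derivative_at)

lemma px_real_eqI:
  "((\<lambda>h. f (x + h *\<^sub>R axis i 1) t) has_real_derivative d) (at 0) \<Longrightarrow> px i f x t = d"
  by (simp add: px_eqI has_real_derivative_iff_has_vector_derivative)

lemma pt_real_eqI:
  "((\<lambda>s. f x s) has_real_derivative d) (at t) \<Longrightarrow> pt f x t = d"
  by (simp add: pt_eqI has_real_derivative_iff_has_vector_derivative)

lemma smooth_fun_has_partial_derivatives:
  fixes F :: "real^3 \<Rightarrow> real \<Rightarrow> real"
  assumes "smooth_fun (\<lambda>p. F (fst p) (snd p))"
  shows "((\<lambda>h. F (x + h *\<^sub>R axis i 1) t) has_real_derivative px i F x t) (at 0)"
    and "((\<lambda>h. px i F (x + h *\<^sub>R axis i 1) t) has_real_derivative px i (px i F) x t) (at 0)"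
    and "((\<lambda>s. F x s) has_real_derivative pt F x t) (at t)"
    and "((\<lambda>s. pt F x s) has_real_derivative pt (pt F) x t) (at t)"
proof -
  define G where "G = (\<lambda>p::(real^3) \<times> real. F (fst p) (snd p))"
  have ex: "(axis i 1, 0) \<in> (Basis :: ((real^3) \<times> real) set)"
    by (auto simp: Basis_prod_def Basis_vec_def)
  have et: "(0, 1) \<in> (Basis :: ((real^3) \<times> real) set)"
    by (simp add: Basis_prod_def)
  have diff: "set vs \<subseteq> Basis \<Longrightarrow> v \<in> Basis \<Longrightarrow>
      (\<lambda>h. iter_dirder vs G (p + h *\<^sub>R v)) differentiable (at 0)" for vs v p
    using assms unfolding smooth_fun_def G_def by blast
  have Gx: "dirder (axis i 1, 0) G = (\<lambda>p. px i F (fst p) (snd p))"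
    by (rule ext) (simp add: dirder_def px_def G_def)
  have Gt: "dirder (0, 1) G = (\<lambda>p. pt F (fst p) (snd p))"
    by (rule ext) (simp add: dirder_def pt_def G_def vector_derivative_at_shift[of "F _"])
  have "(\<lambda>h. F (x + h *\<^sub>R axis i 1) t) differentiable (at 0)"
    using diff[of "[]" "(axis i 1, 0)" "(x, t)"] ex by (simp add: G_def)
  then show "((\<lambda>h. F (x + h *\<^sub>R axis i 1) t) has_real_derivative px i F x t) (at 0)"
    unfolding px_def has_real_derivative_iff_has_vector_derivative
    using vector_derivative_works by blast
  have "(\<lambda>h. px i F (x + h *\<^sub>R axis i 1) t) differentiable (at 0)"
    using diff[of "[(axis i 1, 0)]" "(axis i 1, 0)" "(x, t)"] ex by (simp add: Gx)
  then show "((\<lambda>h. px i F (x + h *\<^sub>R axis i 1) t) has_real_derivative px i (px i F) x t) (at 0)"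
    unfolding px_def[of i "px i F"] has_real_derivative_iff_has_vector_derivative
    using vector_derivative_works by blast
  have "(\<lambda>h. F x (t + h)) differentiable (at 0)"
    using diff[of "[]" "(0, 1)" "(x, t)"] et by (simp add: G_def)
  then show "((\<lambda>s. F x s) has_real_derivative pt F x t) (at t)"
    unfolding pt_def by (rule has_real_derivative_vector_derivative_shift)
  have "(\<lambda>h. pt F x (t + h)) differentiable (at 0)"
    using diff[of "[(0, 1)]" "(0, 1)" "(x, t)"] et by (simp add: Gt)
  then show "((\<lambda>s. pt F x s) has_real_derivative pt (pt F) x t) (at t)"
    unfolding pt_def[of "pt F"] by (rule has_real_derivative_vector_derivative_shift)
qed

lemma has_vector_derivative_cexp:
  fixes g :: "real \<Rightarrow> complex"
  assumes "(g has_vector_derivative g') (at z)"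
  shows "((\<lambda>h. exp (g h)) has_vector_derivative exp (g z) * g') (at z)"
  using field_vector_diff_chain_at[OF assms DERIV_exp] by (simp add: o_def mult.commute)

lemma px_px_exp:
  fixes G G' :: "real^3 \<Rightarrow> real \<Rightarrow> complex"
  assumes "\<And>y s. ((\<lambda>h. G (y + h *\<^sub>R axis i 1) s) has_vector_derivative G' y s) (at 0)"
    and "((\<lambda>h. G' (x + h *\<^sub>R axis i 1) t) has_vector_derivative G'') (at 0)"
  shows "px i (px i (\<lambda>y s. exp (G y s))) x t = exp (G x t) * ((G' x t)\<^sup>2 + G'')"
proof -
  have "px i (\<lambda>y s. exp (G y s)) = (\<lambda>y s. exp (G y s) * G' y s)"
    by (intro ext px_eqI) (use has_vector_derivative_cexp[OF assms(1)] in simp)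
  moreover have "((\<lambda>h. exp (G (x + h *\<^sub>R axis i 1) t) * G' (x + h *\<^sub>R axis i 1) t)
      has_vector_derivative exp (G x t) * ((G' x t)\<^sup>2 + G'')) (at 0)"
    using has_vector_derivative_mult[OF has_vector_derivative_cexp[OF assms(1)] assms(2)]
    by (simp add: algebra_simps power2_eq_square)
  ultimately show ?thesis
    by (simp add: px_eqI)
qed

lemma pt_pt_exp:
  fixes G G' :: "real^3 \<Rightarrow> real \<Rightarrow> complex"
  assumes "\<And>y s. ((\<lambda>u. G y u) has_vector_derivative G' y s) (at s)"
    and "((\<lambda>u. G' x u) has_vector_derivative G'') (at t)"
  shows "pt (pt (\<lambda>y s. exp (G y s))) x t = exp (G x t) * ((G' x t)\<^sup>2 + G'')"
proof -
  have "pt (\<lambda>y s. exp (G y s)) = (\<lambda>y s. exp (G y s) * G' y s)"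
    by (intro ext pt_eqI has_vector_derivative_cexp assms(1))
  moreover have "((\<lambda>u. exp (G x u) * G' x u) has_vector_derivative exp (G x t) * ((G' x t)\<^sup>2 + G'')) (at t)"
    using has_vector_derivative_mult[OF has_vector_derivative_cexp[OF assms(1)] assms(2)]
    by (simp add: algebra_simps power2_eq_square)
  ultimately show ?thesis
    by (simp add: pt_eqI)
qed

lemma Im_phase_square_plus_derivative:
  fixes a a' b b' h :: real
  shows "Im ((of_real a + \<i> / of_real h * of_real b)\<^sup>2 + (of_real a' + \<i> / of_real h * of_real b'))
    = (2 * a * b + b') / h"
  by (cases "h = 0") (simp_all add: power2_eq_square field_simps)

text \<open>\<open>e\<^sup>-\<^sup>2\<^sup>R \<nabla>\<^sub>\<nu>\<cdot>(e\<^sup>2\<^sup>R \<nabla>\<^sub>\<nu>S)\<close>; since \<open>\<partial>/\<partial>x\<^sup>4 = (1/ic) \<partial>/\<partial>t\<close>, the fourth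
  component contributes \<open>-1/c\<^sup>2\<close> times a time derivative.\<close>

definition reduced_current_div ::
    "real \<Rightarrow> (real^3 \<Rightarrow> real \<Rightarrow> real) \<Rightarrow> (real^3 \<Rightarrow> real \<Rightarrow> real) \<Rightarrow> real^3 \<Rightarrow> real \<Rightarrow> real" where
  "reduced_current_div c R S x t =
    (\<Sum>i\<in>UNIV. 2 * px i R x t * px i S x t + px i (px i S) x t)
    - (2 * pt R x t * pt S x t + pt (pt S) x t) / c\<^sup>2"

lemma klein_gordon_imp_reduced_current_div_eq_0:
  fixes R S :: "real^3 \<Rightarrow> real \<Rightarrow> real" and \<phi> :: "real^3 \<Rightarrow> real \<Rightarrow> complex"
  assumes R: "smooth_fun (\<lambda>p. R (fst p) (snd p))" and S: "smooth_fun (\<lambda>p. S (fst p) (snd p))"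
    and hbar: "hbar \<noteq> 0"
    and phi: "\<And>x t. \<phi> x t = exp (of_real (R x t) + (\<i> / of_real hbar) * of_real (S x t))"
    and KG: "lap \<phi> x t - (1 / of_real (c\<^sup>2)) * pt (pt \<phi>) x t = of_real k * \<phi> x t"
  shows "reduced_current_div c R S x t = 0"
proof -
  \<comment> \<open>\<open>phase D\<close> is the derivative \<open>D\<close> applied to \<open>G = R + iS/hbar\<close>\<close>
  define phase where "phase F y s = of_real (F R y s) + (\<i> / of_real hbar) * of_real (F S y s)"
    for F :: "(real^3 \<Rightarrow> real \<Rightarrow> real) \<Rightarrow> real^3 \<Rightarrow> real \<Rightarrow> real" and y s
  note dR = smooth_fun_has_partial_derivatives[OF R]
    and dS = smooth_fun_has_partial_derivatives[OF S]
  have phi_eq: "\<phi> = (\<lambda>y s. exp (phase (\<lambda>F. F) y s))"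
    by (intro ext) (simp add: phi phase_def)
  have "px i (px i \<phi>) x t = \<phi> x t * ((phase (px i) x t)\<^sup>2 + phase (\<lambda>F. px i (px i F)) x t)" for i
    unfolding phi_eq phase_def
    by (intro px_px_exp derivative_intros has_vector_derivative_of_real dR(1,2) dS(1,2))
  then have lap: "lap \<phi> x t = \<phi> x t * (\<Sum>i\<in>UNIV. (phase (px i) x t)\<^sup>2 + phase (\<lambda>F. px i (px i F)) x t)"
    by (simp add: lap_def sum_distrib_left)
  have ptt: "pt (pt \<phi>) x t = \<phi> x t * ((phase pt x t)\<^sup>2 + phase (\<lambda>F. pt (pt F)) x t)"
    unfolding phi_eq phase_def
    by (intro pt_pt_exp derivative_intros has_vector_derivative_of_real dR(3,4) dS(3,4))
  have "\<phi> x t * ((\<Sum>i\<in>UNIV. (phase (px i) x t)\<^sup>2 + phase (\<lambda>F. px i (px i F)) x t)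
      - (1 / of_real (c\<^sup>2)) * ((phase pt x t)\<^sup>2 + phase (\<lambda>F. pt (pt F)) x t)) = \<phi> x t * of_real k"
    using KG unfolding lap ptt by (simp add: algebra_simps)
  moreover have "\<phi> x t \<noteq> 0"
    by (simp add: phi)
  ultimately have "(\<Sum>i\<in>UNIV. (phase (px i) x t)\<^sup>2 + phase (\<lambda>F. px i (px i F)) x t)
      - ((phase pt x t)\<^sup>2 + phase (\<lambda>F. pt (pt F)) x t) / of_real (c\<^sup>2) = of_real k"
    by simp
  from arg_cong[where f = Im, OF this]
  have "(\<Sum>i\<in>UNIV. (2 * px i R x t * px i S x t + px i (px i S) x t) / hbar)
      - (2 * pt R x t * pt S x t + pt (pt S) x t) / hbar / c\<^sup>2 = 0"
    by (simp only: phase_def minus_complex.sel Im_sum Im_divide_of_real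
        Im_phase_square_plus_derivative Im_complex_of_real)
  then have "reduced_current_div c R S x t / hbar = 0"
    by (simp add: reduced_current_div_def diff_divide_distrib sum_divide_distrib)
  with hbar show ?thesis
    by simp
qed

lemma has_real_derivative_exp2_mult:
  assumes "(a has_real_derivative a') (at z)" and "(b has_real_derivative b') (at z)"
  shows "((\<lambda>h. exp (2 * a h) * b h) has_real_derivative exp (2 * a z) * (2 * a' * b z + b')) (at z)"
  by (rule derivative_eq_intros assms refl)+ (simp add: algebra_simps)

lemma grad4_cfun:
  assumes "smooth_fun (\<lambda>p. f (fst p) (snd p))"
  shows "grad4 c (cfun f) y s
    = ((\<chi> i. of_real (px i f y s)), of_real (pt f y s) / (\<i> * of_real c))"
proof -
  have "px i (cfun f) y s = of_real (px i f y s)" for i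
    unfolding cfun_def
    by (intro px_eqI has_vector_derivative_of_real smooth_fun_has_partial_derivatives(1)[OF assms])
  moreover have "pt (cfun f) y s = of_real (pt f y s)"
    unfolding cfun_def
    by (intro pt_eqI has_vector_derivative_of_real smooth_fun_has_partial_derivatives(3)[OF assms])
  ultimately show ?thesis
    by (simp add: grad4_def p4_def)
qed

lemma div4_real_field:
  fixes a :: "3 \<Rightarrow> real^3 \<Rightarrow> real \<Rightarrow> real" and b :: "real^3 \<Rightarrow> real \<Rightarrow> real"
  assumes "\<And>i. ((\<lambda>h. a i (x + h *\<^sub>R axis i 1) t) has_real_derivative a' i) (at 0)"
    and "((\<lambda>s. b x s) has_real_derivative b') (at t)"
  shows "div4 c (\<lambda>y s. ((\<chi> i. of_real (a i y s)), of_real (b y s) / (\<i> * of_real c))) x t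
    = of_real ((\<Sum>i\<in>UNIV. a' i) - b' / c\<^sup>2)"
proof -
  have "px i (\<lambda>y s. of_real (a i y s)) x t = (of_real (a' i) :: complex)" for i
    by (intro px_eqI has_vector_derivative_of_real assms(1))
  moreover have "pt (\<lambda>y s. of_real (b y s) / (\<i> * of_real c)) x t = of_real b' / (\<i> * of_real c)"
    by (intro pt_eqI has_vector_derivative_divide has_vector_derivative_of_real assms(2))
  moreover have "(\<i> * of_real c) * (\<i> * of_real c) = - of_real (c\<^sup>2)"
    by (simp add: power2_eq_square algebra_simps)
  ultimately show ?thesis
    by (simp add: div4_def p4_def)
qed

context
  fixes R :: "real^3 \<Rightarrow> real \<Rightarrow> real"
  assumes R: "smooth_fun (\<lambda>p. R (fst p) (snd p))"
begin

lemma px_exp2_mult: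
  assumes "((\<lambda>h. F (x + h *\<^sub>R axis i 1) t) has_real_derivative F') (at 0)"
  shows "px i (\<lambda>y s. exp (2 * R y s) * F y s) x t = exp (2 * R x t) * (2 * px i R x t * F x t + F')"
  using has_real_derivative_exp2_mult[OF smooth_fun_has_partial_derivatives(1)[OF R] assms]
  by (intro px_real_eqI) simp

lemma pt_exp2_mult:
  assumes "((\<lambda>s. F x s) has_real_derivative F') (at t)"
  shows "pt (\<lambda>y s. exp (2 * R y s) * F y s) x t = exp (2 * R x t) * (2 * pt R x t * F x t + F')"
  using has_real_derivative_exp2_mult[OF smooth_fun_has_partial_derivatives(3)[OF R] assms]
  by (intro pt_real_eqI) simp

lemma lap_exp2:
  "lap (\<lambda>y s. exp (2 * R y s)) x t
    = exp (2 * R x t) * (\<Sum>i\<in>UNIV. 4 * (px i R x t)\<^sup>2 + 2 * px i (px i R) x t)"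
proof -
  have "px i (\<lambda>y s. exp (2 * R y s)) = (\<lambda>y s. exp (2 * R y s) * (2 * px i R y s))" for i
    using px_exp2_mult[where F = "\<lambda>_ _. 1" and F' = 0] by (intro ext) simp
  moreover have "px i (\<lambda>y s. exp (2 * R y s) * (2 * px i R y s)) x t
      = exp (2 * R x t) * (2 * px i R x t * (2 * px i R x t) + 2 * px i (px i R) x t)" for i
    by (intro px_exp2_mult DERIV_cmult smooth_fun_has_partial_derivatives(2)[OF R])
  ultimately show ?thesis
    by (simp add: lap_def sum_distrib_left power2_eq_square algebra_simps)
qed

lemma current_divergence_exp2:
  assumes S: "smooth_fun (\<lambda>p. S (fst p) (snd p))"
  shows "(\<Sum>i\<in>UNIV. px i (\<lambda>y s. exp (2 * R y s) * px i S y s) x t)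
      - (1 / c\<^sup>2) * pt (\<lambda>y s. exp (2 * R y s) * pt S y s) x t
    = exp (2 * R x t) * reduced_current_div c R S x t"
  unfolding px_exp2_mult[OF smooth_fun_has_partial_derivatives(2)[OF S]]
    pt_exp2_mult[OF smooth_fun_has_partial_derivatives(4)[OF S]]
  by (simp add: reduced_current_div_def sum_distrib_left algebra_simps add_divide_distrib)

lemma div4_exp2_real_field:
  assumes "\<And>i. ((\<lambda>h. A i (x + h *\<^sub>R axis i 1) t) has_real_derivative A' i) (at 0)"
    and "((\<lambda>s. B x s) has_real_derivative B') (at t)"
  shows "div4 c (\<lambda>y s. ((\<chi> i. of_real (exp (2 * R y s) * A i y s)),
        of_real (exp (2 * R y s) * B y s) / (\<i> * of_real c))) x t
    = of_real (exp (2 * R x t) *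
        ((\<Sum>i\<in>UNIV. 2 * px i R x t * A i x t + A' i) - (2 * pt R x t * B x t + B') / c\<^sup>2))"
proof -
  note dR = smooth_fun_has_partial_derivatives[OF R]
  have "div4 c (\<lambda>y s. ((\<chi> i. of_real (exp (2 * R y s) * A i y s)),
        of_real (exp (2 * R y s) * B y s) / (\<i> * of_real c))) x t
    = of_real ((\<Sum>i\<in>UNIV. exp (2 * R x t) * (2 * px i R x t * A i x t + A' i))
        - exp (2 * R x t) * (2 * pt R x t * B x t + B') / c\<^sup>2)"
    using has_real_derivative_exp2_mult[OF dR(1) assms(1)]
      has_real_derivative_exp2_mult[OF dR(3) assms(2)]
    by (intro div4_real_field) simp_all
  then show ?thesis
    by (simp add: sum_distrib_left right_diff_distrib)
qed

lemma div4_exp2_grad4: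
  assumes S: "smooth_fun (\<lambda>p. S (fst p) (snd p))"
  shows "div4 c (\<lambda>y s. exp (2 * R y s) *\<^sub>R ((1 / m) *\<^sub>R grad4 c (cfun S) y s)) x t
    = of_real (exp (2 * R x t) / m * reduced_current_div c R S x t)"
proof -
  note dS = smooth_fun_has_partial_derivatives[OF S]
  have "div4 c (\<lambda>y s. exp (2 * R y s) *\<^sub>R ((1 / m) *\<^sub>R grad4 c (cfun S) y s)) x t
    = div4 c (\<lambda>y s. ((\<chi> i. of_real (exp (2 * R y s) * (px i S y s / m))),
        of_real (exp (2 * R y s) * (pt S y s / m)) / (\<i> * of_real c))) x t"
    by (intro arg_cong[where f = "\<lambda>V. div4 c V x t"] ext)
      (simp add: grad4_cfun[OF S] vec_eq_iff, simp add: scaleR_conv_of_real)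
  also have "\<dots> = of_real (exp (2 * R x t) *
      ((\<Sum>i\<in>UNIV. 2 * px i R x t * (px i S x t / m) + px i (px i S) x t / m)
        - (2 * pt R x t * (pt S x t / m) + pt (pt S) x t / m) / c\<^sup>2))"
    by (intro div4_exp2_real_field DERIV_cdivide dS(2,4))
  also have "\<dots> = of_real (exp (2 * R x t) / m * reduced_current_div c R S x t)"
  proof -
    have "(\<Sum>i\<in>UNIV. 2 * px i R x t * (px i S x t / m) + px i (px i S) x t / m)
        = (\<Sum>i\<in>UNIV. 2 * px i R x t * px i S x t + px i (px i S) x t) / m"
      by (simp add: sum_divide_distrib add_divide_distrib)
    then show ?thesis
      by (simp add: reduced_current_div_def diff_divide_distrib add_divide_distrib algebra_simps)
  qed
  finally show ?thesis .
qed

lemma div4_exp2_drift: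
  assumes S: "smooth_fun (\<lambda>p. S (fst p) (snd p))"
  shows "div4 c (\<lambda>y s. exp (2 * R y s) *\<^sub>R drift c m hbar S R y s) x t
    = of_real (exp (2 * R x t) / m * reduced_current_div c R S x t
        + hbar / (2 * m) * lap (\<lambda>y s. exp (2 * R y s)) x t)"
proof -
  note dR = smooth_fun_has_partial_derivatives[OF R]
    and dS = smooth_fun_has_partial_derivatives[OF S]
  have "div4 c (\<lambda>y s. exp (2 * R y s) *\<^sub>R drift c m hbar S R y s) x t
    = div4 c (\<lambda>y s. ((\<chi> i. of_real (exp (2 * R y s) * ((px i S y s + hbar * px i R y s) / m))),
        of_real (exp (2 * R y s) * (pt S y s / m)) / (\<i> * of_real c))) x t"
    by (intro arg_cong[where f = "\<lambda>V. div4 c V x t"] ext)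
      (simp add: drift_def Sigma2_def grad4_cfun[OF S] grad4_cfun[OF R] vec_eq_iff,
        simp add: scaleR_conv_of_real field_simps add_divide_distrib)
  also have "\<dots> = of_real (exp (2 * R x t) *
      ((\<Sum>i\<in>UNIV. 2 * px i R x t * ((px i S x t + hbar * px i R x t) / m)
          + (px i (px i S) x t + hbar * px i (px i R) x t) / m)
        - (2 * pt R x t * (pt S x t / m) + pt (pt S) x t / m) / c\<^sup>2))"
    by (intro div4_exp2_real_field DERIV_cdivide DERIV_add DERIV_cmult dR(2) dS(2,4))
  also have "\<dots> = of_real (exp (2 * R x t) / m * reduced_current_div c R S x t
        + hbar / (2 * m) * lap (\<lambda>y s. exp (2 * R y s)) x t)"
  proof -
    have "(\<Sum>i\<in>UNIV. 2 * px i R x t * ((px i S x t + hbar * px i R x t) / m)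
          + (px i (px i S) x t + hbar * px i (px i R) x t) / m)
        = (\<Sum>i\<in>UNIV. 2 * px i R x t * px i S x t + px i (px i S) x t) / m
          + hbar / (2 * m) * (\<Sum>i\<in>UNIV. 4 * (px i R x t)\<^sup>2 + 2 * px i (px i R) x t)"
      by (simp add: sum_divide_distrib sum_distrib_left flip: sum.distrib)
        (rule sum.cong, simp_all add: power2_eq_square add_divide_distrib algebra_simps)
    then show ?thesis
      by (simp add: lap_exp2 reduced_current_div_def diff_divide_distrib
          add_divide_distrib algebra_simps)
  qed
  finally show ?thesis .
qed

end

theorem mainTheorem1:
  fixes m c hbar :: real
    and R S :: "real^3 \<Rightarrow> real \<Rightarrow> real"
    and \<phi> :: "real^3 \<Rightarrow> real \<Rightarrow> complex"
    and \<rho> :: "real^3 \<Rightarrow> real \<Rightarrow> real"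
    and \<rho>\<^sub>\<nu> :: "real \<Rightarrow> real^3 \<Rightarrow> real \<Rightarrow> real"
  assumes m_pos: "m > 0" and c_pos: "c > 0" and hbar_pos: "hbar > 0"
    and R_smooth: "smooth_fun (\<lambda>p. R (fst p) (snd p))"
    and S_smooth: "smooth_fun (\<lambda>p. S (fst p) (snd p))"
    and phi_def: "\<And>x t. \<phi> x t = exp (complex_of_real (R x t) + (\<i> / complex_of_real hbar) * complex_of_real (S x t))"
    and KG: "\<And>x t. t \<ge> 0 \<Longrightarrow>
        lap \<phi> x t - (1 / complex_of_real (c^2)) * pt (pt \<phi>) x t
          = complex_of_real (m^2 * c^2 / hbar^2) * \<phi> x t"
    and HJ: "\<And>x t. t \<ge> 0 \<Longrightarrow>
        pt S x t + c * sqrt (m^2 * c^2 + (\<Sum>i\<in>UNIV. (px i S x t)^2)) = 0"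
    and rho_def: "\<And>x t. \<rho> x t = (cmod (\<phi> x t))^2"
    and rho_nu_def: "\<And>\<tau> x t. \<rho>\<^sub>\<nu> \<tau> x t = \<rho> x t"
  shows "(\<forall>\<tau> x t. t \<ge> 0 \<longrightarrow>
            complex_of_real (vector_derivative (\<lambda>\<sigma>. \<rho>\<^sub>\<nu> \<sigma> x t) (at \<tau>))
            + div4 c (\<lambda>y s. \<rho>\<^sub>\<nu> \<tau> y s *\<^sub>R drift c m hbar S R y s) x t
            = complex_of_real (hbar / (2 * m) * lap (\<rho>\<^sub>\<nu> \<tau>) x t))
       \<and> (\<forall>x t. t \<ge> 0 \<longrightarrow>
            div4 c (\<lambda>y s. \<rho> y s *\<^sub>R ((1 / m) *\<^sub>R grad4 c (cfun S) y s)) x t = 0)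
       \<and> (\<forall>x t. t \<ge> 0 \<longrightarrow>
            (\<Sum>i\<in>UNIV. px i (\<lambda>y s. (cmod (\<phi> y s))^2 * px i S y s) x t)
            - (1 / c^2) * pt (\<lambda>y s. (cmod (\<phi> y s))^2 * pt S y s) x t = 0)"
proof -
  have current: "reduced_current_div c R S x t = 0" if "t \<ge> 0" for x t
    using klein_gordon_imp_reduced_current_div_eq_0[OF R_smooth S_smooth _ phi_def KG[OF that]]
      hbar_pos by simp
  have density: "(cmod (\<phi> x t))\<^sup>2 = exp (2 * R x t)" for x t
    by (simp add: phi_def flip: exp_of_nat_mult)
  have rho: "\<rho>\<^sub>\<nu> \<tau> = \<rho>" "\<rho> = (\<lambda>y s. exp (2 * R y s))" for \<tau>
    by (simp_all add: rho_nu_def rho_def density fun_eq_iff)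
  show ?thesis
    using div4_exp2_drift[OF R_smooth S_smooth] div4_exp2_grad4[OF R_smooth S_smooth]
      current_divergence_exp2[OF R_smooth S_smooth] current
    by (simp add: rho density)
qed

end
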